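(* Let $p$ be a sufficiently large prime and $\mathcal{A}$ a zero-free subset of $\mathbb{Z}/p\mathbb{Z}$ of the largest cardinality. Then $\operatorname{card}(\mathcal{A})=[\sqrt{2p}]-\delta(p)$, where $\delta(p)=0$ if $s(\sqrt{2p}):=\frac{[\sqrt{2p}]([\sqrt{2p}]+1)}{2}\le p+1$ and $\delta(p)=1$ otherwise. In other words, $\operatorname{card}(\mathcal{A})$ is the largest integer $k$ with $\frac{k(k+1)}{2}\le p+1$; that is, $\operatorname{card}(\mathcal{A})=\left[\sqrt{2p+9/4}-1/2\right]$.
   Context: $\mathcal{A}\subset\mathbb{Z}/p\mathbb{Z}$ is zero-free if $0$ is not a sum of the elements of any nonempty subset of $\mathcal{A}$. $[t]$ denotes the integer part of $t$. *)

theory Defs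
  imports Complex_Main "HOL-Number_Theory.Residues"
begin

text \<open>
  The ring \<^term>\<open>residue_ring (int p)\<close> has carrier \<open>{0..int p - 1}\<close>, so distinct elements of a
  subset are distinct residue classes and \<^term>\<open>card\<close> counts classes.  All subsets of the carrier
  are finite for \<open>p > 0\<close>, so \<^term>\<open>finsum\<close> is a genuine finite sum in the ring.
\<close>

definition zero_free :: "nat \<Rightarrow> int set \<Rightarrow> bool" where
  "zero_free p A \<longleftrightarrow>
     A \<subseteq> carrier (residue_ring (int p)) \<and>
     (\<forall>B. B \<subseteq> A \<and> B \<noteq> {} \<longrightarrow>
        finsum (residue_ring (int p)) (\<lambda>x. x) B \<noteq> \<zero>\<^bsub>residue_ring (int p)\<^esub>)"

definition largest_zero_free :: "nat \<Rightarrow> int set \<Rightarrow> bool" where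
  "largest_zero_free p A \<longleftrightarrow>
     zero_free p A \<and> (\<forall>B. zero_free p B \<longrightarrow> card B \<le> card A)"

definition s_fun :: "real \<Rightarrow> real" where
  "s_fun t = of_int \<lfloor>t\<rfloor> * (of_int \<lfloor>t\<rfloor> + 1) / 2"

definition delta :: "nat \<Rightarrow> int" where
  "delta p = (if s_fun (sqrt (2 * real p)) \<le> real p + 1 then 0 else 1)"

end

theory Submission
  imports Defs "Jordan_Normal_Form.Determinant"
begin

text \<open>
  Enumerate a zero-free set as \<open>a\<^sub>1, \<dots>, a\<^sub>d\<close> and let \<open>W\<close> be the Vandermonde polynomial in \<open>d\<close>
  variables. If \<open>m < d(d+1)/2\<close>, the sum of \<open>(\<Prod>i. \<epsilon>\<^sub>i) W(\<epsilon> a) (\<Sum>i. \<epsilon>\<^sub>i a\<^sub>i) ^ m\<close> over all sign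
  vectors \<open>\<epsilon>\<close> vanishes. If \<open>d(d+1)/2 \<ge> p\<close>, this covers all \<open>m \<le> p - 1\<close>, so the power may be replaced by
  \<open>(\<Sum>i. \<epsilon>\<^sub>i a\<^sub>i - \<Sum>i. a\<^sub>i) ^ (p - 1) - 1\<close>. As the set is zero-free, modulo \<open>p\<close> only \<open>\<epsilon> = (1, \<dots>, 1)\<close>
  contributes, and \<open>p\<close> divides \<open>W(a)\<close>, which is impossible for distinct residues. Hence
  \<open>d(d+1)/2 \<le> p - 1\<close>, and the sets \<open>{1, \<dots>, k}\<close> attain this bound. It agrees with \<open>d(d+1)/2 \<le> p + 1\<close>
  because neither \<open>p\<close> nor \<open>p + 1\<close> is a triangular number for a prime \<open>p \<ge> 7\<close>.
\<close>

section \<open>Vandermonde determinants\<close>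

text \<open>The Leibniz expansion of the Vandermonde determinant. The vanishing argument works on
  its individual monomials over any commutative ring; the product form serves only to read off
  divisibility by \<open>p\<close>.\<close>

definition alternant :: "nat \<Rightarrow> (nat \<Rightarrow> 'a::comm_ring_1) \<Rightarrow> 'a" where
  "alternant n y = (\<Sum>\<sigma> | \<sigma> permutes {..<n}. of_int (sign \<sigma>) * (\<Prod>i<n. y i ^ \<sigma> i))"

lemma alternant_eq_det: "alternant n y = det (mat n n (\<lambda>(i, j). y i ^ j))"
proof -
  have "det (mat n n (\<lambda>(i, j). y i ^ j)) =
      (\<Sum>\<sigma> | \<sigma> permutes {0..<n}. of_int (sign \<sigma>) * (\<Prod>i=0..<n. mat n n (\<lambda>(i, j). y i ^ j) $$ (i, \<sigma> i)))"
    by (subst det_def'[of _ n]) (auto simp: sign_def intro!: sum.cong)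
  also have "\<dots> = (\<Sum>\<sigma> | \<sigma> permutes {0..<n}. of_int (sign \<sigma>) * (\<Prod>i=0..<n. y i ^ \<sigma> i))"
    by (auto intro!: sum.cong prod.cong arg_cong2[where f = times] dest: permutes_in_image)
  finally show ?thesis
    by (simp add: alternant_def atLeast0LessThan)
qed

text \<open>The Vandermonde matrix times the unitriangular coefficient matrix of the monic polynomials
  \<open>\<Prod>l<j. (X - y l)\<close> is lower triangular.\<close>

lemma alternant_eq_prod:
  fixes y :: "nat \<Rightarrow> 'a::idom"
  shows "alternant n y = (\<Prod>i<n. \<Prod>l<i. y i - y l)"
proof -
  define f where "f j = (\<Prod>l<j. [:- y l, 1:])" for j
  have monic: "degree (f j) = j \<and> lead_coeff (f j) = 1" for j
  proof (induction j)
    case (Suc j)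
    have "f (Suc j) = f j * [:- y j, 1:]"
      by (simp add: f_def)
    moreover have "f j \<noteq> 0"
      by (simp add: f_def)
    ultimately have "degree (f (Suc j)) = degree (f j) + degree [:- y j, 1:]"
      and "lead_coeff (f (Suc j)) = lead_coeff (f j) * lead_coeff [:- y j, 1:]"
      by (simp_all only: lead_coeff_mult, subst degree_mult_eq) simp_all
    moreover have "degree (f j) = j" "coeff (f j) j = 1"
      using Suc by auto
    ultimately show ?case
      by simp
  qed (simp add: f_def)
  define V where "V = mat n n (\<lambda>(i, j). y i ^ j)"
  define U where "U = mat n n (\<lambda>(k, j). coeff (f j) k)"
  have carr: "V \<in> carrier_mat n n" "U \<in> carrier_mat n n"
    by (auto simp: V_def U_def)
  have VU: "V * U = mat n n (\<lambda>(i, j). poly (f j) (y i))"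
  proof (rule eq_matI)
    fix i j assume "i < dim_row (mat n n (\<lambda>(i, j). poly (f j) (y i)))"
      and "j < dim_col (mat n n (\<lambda>(i, j). poly (f j) (y i)))"
    then have ij: "i < n" "j < n"
      by auto
    have "(V * U) $$ (i, j) = (\<Sum>k<n. y i ^ k * coeff (f j) k)"
      using ij by (simp add: V_def U_def scalar_prod_def atLeast0LessThan)
    also have "\<dots> = (\<Sum>k\<le>degree (f j). coeff (f j) k * y i ^ k)"
      using ij monic[of j] by (intro sum.mono_neutral_cong_right) (auto simp: coeff_eq_0)
    finally show "(V * U) $$ (i, j) = mat n n (\<lambda>(i, j). poly (f j) (y i)) $$ (i, j)"
      using ij by (simp add: poly_altdef)
  qed (auto simp: V_def U_def)
  have "det U = prod_list (diag_mat U)"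
    by (rule det_upper_triangular[OF _ carr(2)])
      (use monic in \<open>auto simp: upper_triangular_def U_def intro!: coeff_eq_0\<close>)
  also have "\<dots> = 1"
    using monic by (auto simp: prod_list_diag_prod U_def intro!: prod.neutral) metis
  finally have "alternant n y = det V * det U"
    by (simp add: alternant_eq_det V_def)
  also have "\<dots> = det (V * U)"
    using carr by (simp add: det_mult)
  \<comment> \<open>For \<open>i < j\<close> the point \<open>y i\<close> is a root of
    \<open>f j\<close>, so all entries above the diagonal vanish.\<close>
  also have "\<dots> = prod_list (diag_mat (V * U))"
    by (rule det_lower_triangular[of n])
      (auto simp: VU f_def poly_prod intro!: prod_zero)
  also have "\<dots> = (\<Prod>i<n. \<Prod>l<i. y i - y l)"
    by (simp add: prod_list_diag_prod VU f_def poly_prod atLeast0LessThan)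
  finally show ?thesis .
qed

section \<open>Monomials of the alternant times a power of the sum\<close>

text \<open>The exponent vector of the monomial picked by \<open>\<sigma>\<close> from the alternant and by \<open>f\<close> from the
  \<open>m\<close> factors of the power sum.\<close>

definition expo :: "nat \<Rightarrow> (nat \<Rightarrow> nat) \<times> (nat \<Rightarrow> nat) \<Rightarrow> nat \<Rightarrow> nat" where
  "expo m = (\<lambda>(\<sigma>, f) i. \<sigma> i + card {l. l < m \<and> f l = i})"

text \<open>Indexing by choice functions instead of multi-indices avoids multinomial coefficients
  and lets a transposition of the variables act on the index set by composition.\<close>

lemma power_sum_expand:
  fixes y :: "nat \<Rightarrow> 'a::comm_ring_1"
  shows "(\<Sum>i<n. y i) ^ m =
    (\<Sum>f\<in>{..<m} \<rightarrow>\<^sub>E {..<n}. \<Prod>i<n. y i ^ card {l. l < m \<and> f l = i})"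
proof -
  have "(\<Sum>i<n. y i) ^ m = (\<Prod>l<m. \<Sum>i<n. y i)"
    by simp
  also have "\<dots> = (\<Sum>f\<in>{..<m} \<rightarrow>\<^sub>E {..<n}. \<Prod>l<m. y (f l))"
    by (rule prod_sum_PiE) auto
  also have "\<dots> = (\<Sum>f\<in>{..<m} \<rightarrow>\<^sub>E {..<n}. \<Prod>i<n. y i ^ card {l. l < m \<and> f l = i})"
  proof (rule sum.cong[OF refl])
    fix f assume f: "f \<in> {..<m} \<rightarrow>\<^sub>E {..<n}"
    have "(\<Prod>l<m. y (f l)) = (\<Prod>i<n. \<Prod>l\<in>{l. l \<in> {..<m} \<and> f l = i}. y (f l))"
      using f by (intro prod.group[symmetric]) auto
    also have "\<dots> = (\<Prod>i<n. y i ^ card {l. l < m \<and> f l = i})"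
      by (intro prod.cong) auto
    finally show "(\<Prod>l<m. y (f l)) = (\<Prod>i<n. y i ^ card {l. l < m \<and> f l = i})" .
  qed
  finally show ?thesis .
qed

lemma alternant_power_sum:
  fixes y :: "nat \<Rightarrow> 'a::comm_ring_1"
  shows "alternant n y * (\<Sum>i<n. y i) ^ m =
    (\<Sum>x\<in>{\<sigma>. \<sigma> permutes {..<n}} \<times> ({..<m} \<rightarrow>\<^sub>E {..<n}).
      of_int (sign (fst x)) * (\<Prod>i<n. y i ^ expo m x i))"
  unfolding alternant_def power_sum_expand sum_product sum.cartesian_product
  by (intro sum.cong refl)
    (simp only: expo_def power_add prod.distrib mult.assoc case_prod_beta)

lemma sum_expo:
  assumes "\<sigma> permutes {..<n}" and "f \<in> {..<m} \<rightarrow>\<^sub>E {..<n}"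
  shows "(\<Sum>i<n. expo m (\<sigma>, f) i) = (\<Sum>i<n. i) + m"
proof -
  have "(\<Sum>i<n. card {l. l < m \<and> f l = i}) = (\<Sum>i<n. \<Sum>l\<in>{l. l \<in> {..<m} \<and> f l = i}. 1)"
    by (intro sum.cong) auto
  also have "\<dots> = (\<Sum>l<m. 1)"
    using assms(2) by (intro sum.group) auto
  finally show ?thesis
    using sum.permute[OF assms(1), of "\<lambda>i. i"] by (simp add: expo_def sum.distrib comp_def)
qed

text \<open>Halving turns distinct odd numbers into distinct naturals, whose sum is at least 0 + 1 +
  ... + (\<open>card I\<close> - 1).\<close>

lemma card_square_le_sum_odd:
  assumes "finite I" and "inj_on e I" and "\<And>i. i \<in> I \<Longrightarrow> odd (e i)"
  shows "card I ^ 2 \<le> (\<Sum>i\<in>I. e i :: nat)"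
proof -
  have "inj_on (\<lambda>i. e i div 2) I"
    using assms(2,3) by (auto simp: inj_on_def) (metis odd_two_times_div_two_succ)
  then have "\<Sum>{0..<card I} \<le> (\<Sum>i\<in>I. e i div 2)"
    using card_sum_le_nat_sum[of "(\<lambda>i. e i div 2) ` I"] assms(1)
    by (simp add: card_image sum.reindex)
  moreover have "(\<Sum>i\<in>I. e i) = (\<Sum>i\<in>I. 2 * (e i div 2) + 1)"
    using assms(3) by (intro sum.cong) auto
  moreover have "\<dots> = 2 * (\<Sum>i\<in>I. e i div 2) + card I"
    by (subst sum.distrib) (simp add: sum_distrib_left)
  moreover have "2 * \<Sum>{0..<n} + n = n ^ 2" for n :: nat
    by (induction n) (auto simp: power2_eq_square)
  ultimately show ?thesis
    by (metis add_le_mono1 mult_le_mono2)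
qed

text \<open>If \<open>e i = e k\<close>, composing \<open>\<sigma>\<close> and \<open>f\<close> with the transposition of \<open>i\<close> and \<open>k\<close> is a sign-reversing
  involution on the pairs with exponent vector \<open>e\<close>.\<close>

lemma alternating_coefficient_eq_0:
  assumes "i < n" "k < n" "i \<noteq> k" "e i = e k"
  shows "(\<Sum>x | x \<in> {\<sigma>. \<sigma> permutes {..<n}} \<times> ({..<m} \<rightarrow>\<^sub>E {..<n}) \<and> expo m x = e. sign (fst x)) = 0"
    (is "sum _ ?X = 0")
proof -
  define \<tau> where "\<tau> = Transposition.transpose i k"
  \<comment> \<open>\<open>restrict\<close> keeps the second component extensional:
    \<open>\<tau>\<close> might move the value \<open>undefined\<close> taken outside
    \<open>{..<m}\<close>.\<close>
  define \<Phi> where "\<Phi> = (\<lambda>(\<sigma> :: nat \<Rightarrow> nat, f). (\<sigma> \<circ> \<tau>, restrict (\<tau> \<circ> f) {..<m}))"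
  have \<tau>: "\<tau> permutes {..<n}" "\<And>x. \<tau> (\<tau> x) = x" "\<And>x. e (\<tau> x) = e x" "sign \<tau> = -1"
    using assms by (auto simp: \<tau>_def permutes_swap_id sign_swap_id Transposition.transpose_def)
  have \<Phi>_in: "\<Phi> x \<in> ?X" if "x \<in> ?X" for x
  proof -
    obtain \<sigma> f where "x = (\<sigma>, f)"
      by (cases x)
    with that have x: "x = (\<sigma>, f)" "\<sigma> permutes {..<n}" "f \<in> {..<m} \<rightarrow>\<^sub>E {..<n}" "expo m (\<sigma>, f) = e"
      by simp_all
    have "expo m (\<Phi> x) j = expo m (\<sigma>, f) (\<tau> j)" for j
    proof -
      have "{l. l < m \<and> restrict (\<tau> \<circ> f) {..<m} l = j} = {l. l < m \<and> f l = \<tau> j}"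
        using \<tau>(2) by (auto simp: restrict_def)
      then show ?thesis
        by (simp add: \<Phi>_def expo_def x(1))
    qed
    then have "expo m (\<Phi> x) = e"
      using x(4) \<tau>(3) by auto
    moreover have "\<tau> (f l) < n" if "l < m" for l
      using that x(3) permutes_in_image[OF \<tau>(1), of "f l"] by auto
    ultimately show ?thesis
      using x permutes_compose[OF \<tau>(1) x(2)] by (auto simp: \<Phi>_def)
  qed
  have \<Phi>_inv: "\<Phi> (\<Phi> x) = x" if "x \<in> ?X" for x
  proof -
    obtain \<sigma> f where "x = (\<sigma>, f)"
      by (cases x)
    with that have x: "x = (\<sigma>, f)" "f \<in> {..<m} \<rightarrow>\<^sub>E {..<n}"
      by simp_all
    have "restrict (\<tau> \<circ> restrict (\<tau> \<circ> f) {..<m}) {..<m} = f"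
      by (rule extensionalityI[of _ "{..<m}"]) (use x(2) in \<open>simp_all add: PiE_def \<tau>(2)\<close>)
    moreover have "\<sigma> \<circ> \<tau> \<circ> \<tau> = \<sigma>"
      by (simp add: fun_eq_iff \<tau>(2))
    ultimately show ?thesis
      by (simp add: \<Phi>_def x(1))
  qed
  have sgn: "sign (fst (\<Phi> x)) = - sign (fst x)" if "x \<in> ?X" for x
  proof -
    obtain \<sigma> f where "x = (\<sigma>, f)"
      by (cases x)
    with that have x: "x = (\<sigma>, f)" "\<sigma> permutes {..<n}"
      by simp_all
    have "sign (\<sigma> \<circ> \<tau>) = sign \<sigma> * sign \<tau>"
      using permutes_imp_permutation[OF finite_lessThan x(2)]
        permutes_imp_permutation[OF finite_lessThan \<tau>(1)] by (rule sign_compose)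
    then show ?thesis
      by (simp add: \<Phi>_def x(1) \<tau>(4))
  qed
  \<comment> \<open>The coefficient is an integer, so equality with its own negative makes it 0; a
    general commutative ring may have 2-torsion.\<close>
  have "(\<Sum>x\<in>?X. sign (fst x)) = (\<Sum>x\<in>?X. - sign (fst x))"
    by (rule sum.reindex_bij_witness[of _ \<Phi> \<Phi>])
      (simp_all only: \<Phi>_in \<Phi>_inv sgn minus_minus)
  then show ?thesis
    by (simp add: sum_negf)
qed

section \<open>Sums over all sign vectors\<close>

text \<open>\<open>X\<close> encodes the sign vector that is -1 exactly on \<open>X\<close>; the
  product of its signs is \<open>(-1) ^ card X\<close>.\<close>

definition flip :: "nat set \<Rightarrow> (nat \<Rightarrow> 'a::uminus) \<Rightarrow> nat \<Rightarrow> 'a" where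
  "flip X a i = (if i \<in> X then - a i else a i)"

text \<open>When the right side is expanded, \<open>X\<close> is the set of indices at which the
  second term is chosen. A factor with even exponent is 0.\<close>

lemma signed_sum_monomial:
  fixes a :: "nat \<Rightarrow> 'a::comm_ring_1"
  shows "(\<Sum>X\<in>Pow {..<n}. (-1) ^ card X * (\<Prod>i<n. flip X a i ^ e i)) =
    (\<Prod>i<n. a i ^ e i - (- a i) ^ e i)"
proof -
  have "(\<Prod>i<n. flip X a i ^ e i) = (\<Prod>i\<in>X. (- a i) ^ e i) * (\<Prod>i\<in>{..<n} - X. a i ^ e i)"
    if "X \<subseteq> {..<n}" for X
    using that prod.subset_diff[OF that, of "\<lambda>i. flip X a i ^ e i"]
    by (simp add: flip_def mult.commute)
  then show ?thesis
    by (subst prod_diff_conv_sum) (auto intro!: sum.cong simp: mult.assoc)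
qed

text \<open>Only monomials with all exponents odd survive the signed sum, and by antisymmetry only those
  with distinct exponents; \<open>n\<close> distinct odd exponents add up to at least \<open>n\<^sup>2\<close>, which exceeds the
  degree.\<close>

lemma signed_sum_alternant_eq_0:
  fixes a :: "nat \<Rightarrow> 'a::comm_ring_1"
  assumes "2 * m < n * (n + 1)"
  shows "(\<Sum>X\<in>Pow {..<n}. (-1) ^ card X * (alternant n (flip X a) * (\<Sum>i<n. flip X a i) ^ m)) = 0"
proof -
  define S where "S = {\<sigma>. \<sigma> permutes {..<n}} \<times> ({..<m} \<rightarrow>\<^sub>E {..<n})"
  define G where "G e = (\<Prod>i<n. a i ^ e i - (- a i) ^ e i)" for e :: "nat \<Rightarrow> nat"
  have fin: "finite S"
    by (auto simp: S_def finite_permutations intro!: finite_PiE)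
  have "(\<Sum>X\<in>Pow {..<n}. (-1) ^ card X * (alternant n (flip X a) * (\<Sum>i<n. flip X a i) ^ m)) =
      (\<Sum>X\<in>Pow {..<n}. \<Sum>x\<in>S. of_int (sign (fst x)) * ((-1) ^ card X * (\<Prod>i<n. flip X a i ^ expo m x i)))"
    by (simp add: alternant_power_sum S_def sum_distrib_left mult_ac)
  also have "\<dots> = (\<Sum>x\<in>S. of_int (sign (fst x)) * G (expo m x))"
    by (subst sum.swap) (simp add: G_def signed_sum_monomial flip: sum_distrib_left)
  also have "\<dots> = (\<Sum>e\<in>expo m ` S. \<Sum>x | x \<in> S \<and> expo m x = e. of_int (sign (fst x)) * G (expo m x))"
    by (rule sum.image_gen[OF fin])
  also have "\<dots> = (\<Sum>e\<in>expo m ` S. of_int (\<Sum>x | x \<in> S \<and> expo m x = e. sign (fst x)) * G e)"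
  proof (rule sum.cong[OF refl])
    fix e
    have "(\<Sum>x | x \<in> S \<and> expo m x = e. of_int (sign (fst x)) * G (expo m x)) =
        (\<Sum>x | x \<in> S \<and> expo m x = e. of_int (sign (fst x)) * G e)"
      by (rule sum.cong) simp_all
    then show "(\<Sum>x | x \<in> S \<and> expo m x = e. of_int (sign (fst x)) * G (expo m x)) =
        of_int (\<Sum>x | x \<in> S \<and> expo m x = e. sign (fst x)) * G e"
      by (simp only: of_int_sum sum_distrib_right)
  qed
  also have "\<dots> = 0"
  proof (intro sum.neutral ballI)
    fix e assume "e \<in> expo m ` S"
    then obtain \<sigma> f where "(\<sigma>, f) \<in> S" and e: "e = expo m (\<sigma>, f)"
      by (metis imageE surj_pair)
    then have sum_e: "(\<Sum>i<n. e i) = (\<Sum>i<n. i) + m"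
      unfolding e S_def by (intro sum_expo) simp_all
    \<comment> \<open>The degree is n(n-1)/2 + m, and m < n(n+1)/2 puts it below n^2.\<close>
    have "2 * (\<Sum>i<n. i) + n = n ^ 2"
      by (induction n) (auto simp: power2_eq_square)
    with assms sum_e have less: "(\<Sum>i<n. e i) < n ^ 2"
      by (simp add: power2_eq_square)
    show "of_int (\<Sum>x | x \<in> S \<and> expo m x = e. sign (fst x)) * G e = 0"
    proof (cases "inj_on e {..<n}")
      case True
      then obtain i where "i < n" "even (e i)"
        using card_square_le_sum_odd[of "{..<n}" e] less by auto
      then have "G e = 0"
        unfolding G_def by (intro prod_zero bexI[of _ i]) simp_all
      then show ?thesis by simp
    next
      case False
      then obtain i k where "i < n" "k < n" "i \<noteq> k" "e i = e k"
        by (auto simp: inj_on_def)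
      then show ?thesis
        using alternating_coefficient_eq_0[of i n k e m] by (simp add: S_def)
    qed
  qed
  finally show ?thesis .
qed

section \<open>The upper bound for zero-free sets\<close>

lemma fermat_theorem_int:
  fixes x :: int
  assumes "prime p" and "\<not> int p dvd x"
  shows "int p dvd x ^ (p - 1) - 1"
proof -
  define y where "y = nat (x mod int p)"
  have y: "int y = x mod int p"
    using assms(1) by (simp add: y_def prime_gt_0_nat)
  then have "\<not> p dvd y"
    using assms(2) by (metis dvd_mod_iff dvd_refl int_dvd_int_iff)
  then have "[int y ^ (p - 1) = 1] (mod int p)"
    using fermat_theorem[OF assms(1)] by (metis cong_int_iff of_nat_1 of_nat_power)
  then have "[x ^ (p - 1) = 1] (mod int p)"
    unfolding y by (simp add: cong_def power_mod)
  then show ?thesis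
    by (simp add: cong_iff_dvd_diff)
qed

lemma zero_free_iff:
  assumes "p > 1"
  shows "zero_free p A \<longleftrightarrow> A \<subseteq> {0..int p - 1} \<and> (\<forall>B\<subseteq>A. B \<noteq> {} \<longrightarrow> \<not> int p dvd \<Sum>B)"
proof -
  interpret residues "int p" "residue_ring (int p)"
    using assms by unfold_locales auto
  have sum_eq: "finsum (residue_ring (int p)) (\<lambda>x. x) B = \<Sum>B mod int p" if "B \<subseteq> {0..int p - 1}" for B
  proof -
    have "finsum (residue_ring (int p)) (\<lambda>x. x) B = finsum (residue_ring (int p)) (\<lambda>x. x mod int p) B"
      using that by (intro finsum_cong') (auto simp: res_carrier_eq subset_iff)
    also have "\<dots> = \<Sum>B mod int p"
      using that by (intro sum_cong) (auto intro: finite_subset)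
    finally show ?thesis .
  qed
  show ?thesis
    unfolding zero_free_def res_carrier_eq res_zero_eq dvd_eq_mod_eq_0
    by (intro conj_cong refl) (metis sum_eq order_trans)
qed

text \<open>By Fermat, modulo \<open>p\<close> the factor \<open>(\<Sum>i. flip X a i - s) ^ (p - 1) - 1\<close> vanishes
  for every sign pattern but \<open>X = {}\<close>.\<close>

lemma zero_free_card_bound:
  assumes p: "prime p" "odd p" and A: "zero_free p A"
  shows "card A * (card A + 1) < 2 * p"
proof (rule ccontr)
  assume "\<not> card A * (card A + 1) < 2 * p"
  define n where "n = card A"
  have n: "2 * p \<le> n * (n + 1)"
    using \<open>\<not> card A * (card A + 1) < 2 * p\<close> by (simp add: n_def)
  have "p > 1"
    by (rule prime_gt_1_nat[OF p(1)])
  note zf = zero_free_iff[OF \<open>p > 1\<close>, THEN iffD1, OF A]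
  have "finite A"
    using zf by (auto intro: finite_subset)
  then obtain a where a: "bij_betw a {..<n} A"
    unfolding n_def using ex_bij_betw_nat_finite[of A] by (auto simp: atLeast0LessThan)
  then have inj: "inj_on a {..<n}" and img: "a ` {..<n} = A"
    by (auto simp: bij_betw_def)
  define s where "s = (\<Sum>i<n. a i)"
  define u where "u X = (\<Sum>i<n. flip X a i)" for X
  define c where "c X = (-1) ^ card X * alternant n (flip X a)" for X
  \<comment> \<open>These moments vanish exactly, over the integers, since m < p \<le> n(n+1)/2;
    reduction modulo \<open>p\<close> enters only with Fermat.\<close>
  have moment: "(\<Sum>X\<in>Pow {..<n}. c X * u X ^ m) = 0" if "m < p" for m
    using signed_sum_alternant_eq_0[of m n a] that n by (simp add: c_def u_def mult.assoc)
  have "(\<Sum>X\<in>Pow {..<n}. c X * (u X - s) ^ (p - 1)) =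
      (\<Sum>X\<in>Pow {..<n}. \<Sum>m\<le>p - 1. of_nat (p - 1 choose m) * (- s) ^ (p - 1 - m) * (c X * u X ^ m))"
    using binomial_ring[of _ "- s" "p - 1"] by (simp add: sum_distrib_left mult_ac)
  also have "\<dots> = (\<Sum>m\<le>p - 1. of_nat (p - 1 choose m) * (- s) ^ (p - 1 - m) *
      (\<Sum>X\<in>Pow {..<n}. c X * u X ^ m))"
    by (subst sum.swap) (simp add: sum_distrib_left)
  also have "\<dots> = 0"
    using \<open>p > 1\<close> by (intro sum.neutral ballI) (simp add: moment)
  \<comment> \<open>\<open>moment[of 0]\<close> says that the \<open>c X\<close> add up to 0, so 1
    may be subtracted from each power.\<close>
  finally have "(\<Sum>X\<in>Pow {..<n}. c X * ((u X - s) ^ (p - 1) - 1)) = 0"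
    using moment[of 0] \<open>p > 1\<close> by (simp add: right_diff_distrib sum_subtractf)
  then have split: "c {} * ((u {} - s) ^ (p - 1) - 1) +
      (\<Sum>X\<in>Pow {..<n} - {{}}. c X * ((u X - s) ^ (p - 1) - 1)) = 0"
    by (subst (asm) sum.remove[of _ "{}"]) auto
  have "int p dvd c X * ((u X - s) ^ (p - 1) - 1)" if "X \<in> Pow {..<n} - {{}}" for X
  proof -
    have X: "X \<subseteq> {..<n}" "X \<noteq> {}"
      using that by auto
    \<comment> \<open>Flipping the signs in \<open>X\<close> lowers the total by twice the subset
      sum over \<open>X\<close>, which is nonzero modulo \<open>p\<close> because \<open>p\<close>
      is odd and \<open>A\<close> is zero-free.\<close>
    have "u X - s = (\<Sum>i<n. if i \<in> X then - 2 * a i else 0)"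
      unfolding u_def s_def sum_subtractf[symmetric] by (intro sum.cong) (auto simp: flip_def)
    also have "\<dots> = (\<Sum>i\<in>X. - 2 * a i)"
      using X by (subst sum.inter_restrict[symmetric]) (auto simp: Int_absorb1)
    also have "\<dots> = - 2 * \<Sum>(a ` X)"
      using inj_on_subset[OF inj X(1)] by (simp add: sum.reindex sum_distrib_left)
    finally have us: "u X - s = - 2 * \<Sum>(a ` X)" .
    have "\<not> int p dvd \<Sum>(a ` X)"
      using zf X img by (metis image_is_empty image_mono)
    moreover have "\<not> int p dvd - 2"
      using p by (metis dvd_minus_iff int_dvd_int_iff of_nat_numeral primes_dvd_imp_eq two_is_prime_nat even_numeral)
    ultimately have "\<not> int p dvd u X - s"
      unfolding us using p by (simp add: prime_dvd_mult_iff)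
    then show ?thesis
      using fermat_theorem_int[OF p(1)] by simp
  qed
  then have "int p dvd (\<Sum>X\<in>Pow {..<n} - {{}}. c X * ((u X - s) ^ (p - 1) - 1))"
    by (rule dvd_sum)
  moreover have "c {} * ((u {} - s) ^ (p - 1) - 1) =
      - (\<Sum>X\<in>Pow {..<n} - {{}}. c X * ((u X - s) ^ (p - 1) - 1))"
    using split by (simp only: eq_neg_iff_add_eq_0)
  ultimately have "int p dvd c {} * ((u {} - s) ^ (p - 1) - 1)"
    by (simp only: dvd_minus_iff)
  \<comment> \<open>Here \<open>u {} = s\<close>, so the second factor is 0^(p-1) - 1 = -1, and
    \<open>c {}\<close> is the Vandermonde product of \<open>a\<close>.\<close>
  then have "int p dvd (\<Prod>i<n. \<Prod>l<i. a i - a l)"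
    using \<open>p > 1\<close> by (simp add: c_def u_def s_def flip_def alternant_eq_prod power_0_left)
  moreover have pp: "prime (int p)"
    using p by simp
  ultimately obtain i where i: "i < n" and "int p dvd (\<Prod>l<i. a i - a l)"
    unfolding prime_dvd_prod_iff[OF finite_lessThan pp] by blast
  then obtain l where "l < i" "int p dvd a i - a l"
    unfolding prime_dvd_prod_iff[OF finite_lessThan pp] by blast
  note il = i this
  have "a i \<in> A" "a l \<in> A"
    unfolding img[symmetric] using il(1,2) by simp_all
  then have "a i \<in> {0..int p - 1}" "a l \<in> {0..int p - 1}"
    using zf by blast+
  then have "a i = a l"
    using il(3) by (simp add: mod_eq_dvd_iff[symmetric])
  then show False
    using inj_onD[OF inj, of i l] il(1,2) by simp
qed

section \<open>Extremal intervals and triangular numbers\<close>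

text \<open>Every nonempty subset sum is positive and at most k(k+1)/2, hence strictly between 0 and
  p.\<close>

lemma zero_free_interval:
  assumes "p > 1" and "k * (k + 1) < 2 * p"
  shows "zero_free p {1..int k}"
  unfolding zero_free_iff[OF \<open>p > 1\<close>]
proof (intro conjI allI impI)
  have "k < p"
  proof (rule ccontr)
    assume "\<not> k < p"
    then have "p * 2 \<le> k * (k + 1)"
      using \<open>p > 1\<close> by (intro mult_mono) auto
    then show False
      using assms(2) by simp
  qed
  then show "{1..int k} \<subseteq> {0..int p - 1}"
    by auto
  fix B assume B: "B \<subseteq> {1..int k}" "B \<noteq> {}"
  have "finite B"
    using B by (auto intro: finite_subset)
  then have pos: "\<Sum>B > 0"
    using B by (intro sum_pos) auto
  have tri: "2 * \<Sum>{1..int j} = int (j * (j + 1))" for j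
  proof (induction j)
    case (Suc j)
    have "{1..int (Suc j)} = insert (int j + 1) {1..int j}"
      by auto
    then show ?case
      using Suc by (simp add: algebra_simps)
  qed simp
  have "2 * \<Sum>B \<le> 2 * \<Sum>{1..int k}"
    using B by (intro mult_left_mono sum_mono2) auto
  also have "\<dots> < int (2 * p)"
    unfolding tri using assms(2) by (simp only: of_nat_less_iff)
  finally have "\<Sum>B < int p"
    by simp
  with pos show "\<not> int p dvd \<Sum>B"
    by (auto dest: zdvd_imp_le)
qed

text \<open>k(k+1) = 2p makes p divide k or k+1, and k(k+1) = 2p+2, rewritten as (k-1)(k+2) = 2p,
  makes p divide k-1 or k+2. All of these are positive and smaller than p.\<close>

lemma prime_triangular_gap:
  assumes "prime (p::nat)" and "p \<ge> 7" and "k * (k + 1) \<le> 2 * p + 2"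
  shows "k * (k + 1) < 2 * p"
proof (rule ccontr)
  have small: "k + 3 \<le> p"
  proof (rule ccontr)
    assume "\<not> k + 3 \<le> p"
    \<comment> \<open>The resulting (p-2)(p-1) \<le> 2p+2 amounts to p \<le> 5. The case p = 5, k =
      3 is a genuine exception, as p+1 = 6 is triangular.\<close>
    then have "(p - 2) * (p - 1) \<le> k * (k + 1)"
      by (intro mult_mono) auto
    moreover obtain q where "p = q + 7"
      using \<open>p \<ge> 7\<close> by (metis add.commute le_Suc_ex)
    ultimately show False
      using assms(3) by (simp add: algebra_simps)
  qed
  assume "\<not> k * (k + 1) < 2 * p"
  moreover obtain q where "k * (k + 1) = 2 * q"
    by (rule evenE[of "k * (k + 1)"]) simp_all
  ultimately have "k * (k + 1) = 2 * q" "p \<le> q" "q \<le> p + 1"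
    using assms(3) by linarith+
  then consider "k * (k + 1) = 2 * p" | "k * (k + 1) = 2 * p + 2"
    by (cases "q = p") auto
  then show False
  proof cases
    case 1
    then have "p dvd k * (k + 1)"
      by simp
    then have "p dvd k \<or> p dvd k + 1"
      using assms(1) by (simp only: prime_dvd_mult_iff)
    moreover have "k > 0"
      using 1 \<open>p \<ge> 7\<close> by (cases k) auto
    ultimately show False
      using small by (auto dest!: dvd_imp_le)
  next
    case 2
    then have "k \<ge> 2"
      using \<open>p \<ge> 7\<close> by (cases k; cases "k - 1") auto
    then obtain j where k: "k = j + 2"
      by (metis add.commute le_Suc_ex)
    with 2 have "(j + 1) * (j + 4) = 2 * p"
      by (simp add: algebra_simps)
    then have "p dvd (j + 1) * (j + 4)"
      by simp
    then have "p dvd j + 1 \<or> p dvd j + 4"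
      using assms(1) by (simp only: prime_dvd_mult_iff)
    then show False
      using small k by (auto dest!: dvd_imp_le)
  qed
qed

text \<open>This threshold property determines \<open>card A\<close>, so each closed form in the
  theorem reduces to arithmetic with k(k+1).\<close>

lemma largest_zero_free_card:
  assumes "prime p" and "p \<ge> 7" and "largest_zero_free p A"
  shows "k * (k + 1) \<le> 2 * p + 2 \<longleftrightarrow> k \<le> card A"
proof
  have "p > 1" "odd p"
    using assms(1,2) prime_odd_nat[of p] by auto
  {
    assume "k * (k + 1) \<le> 2 * p + 2"
    then have "zero_free p {1..int k}"
      using zero_free_interval[OF \<open>p > 1\<close>] prime_triangular_gap[OF assms(1,2)] by blast
    then show "k \<le> card A"
      using assms(3) by (fastforce simp: largest_zero_free_def)
  next
    assume "k \<le> card A"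
    then have "k * (k + 1) \<le> card A * (card A + 1)"
      by (intro mult_mono) auto
    also have "\<dots> < 2 * p"
      using zero_free_card_bound assms(1,3) \<open>odd p\<close> by (auto simp: largest_zero_free_def)
    finally show "k * (k + 1) \<le> 2 * p + 2"
      by simp
  }
qed

theorem theorem6:
  "\<exists>p0::nat. \<forall>p\<ge>p0. prime p \<longrightarrow>
     (\<forall>A. largest_zero_free p A \<longrightarrow>
        int (card A) = \<lfloor>sqrt (2 * real p)\<rfloor> - delta p \<and>
        (real (card A) * (real (card A) + 1) / 2 \<le> real p + 1 \<and>
         (\<forall>k::int. real_of_int k * (real_of_int k + 1) / 2 \<le> real p + 1 \<longrightarrow> k \<le> int (card A))) \<and>
        int (card A) = \<lfloor>sqrt (2 * real p + 9 / 4) - 1 / 2\<rfloor>)"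
proof (intro exI[of _ 7] allI impI conjI)
  fix p :: nat and A :: "int set"
  assume p: "p \<ge> 7" "prime p" and A: "largest_zero_free p A"
  define d where "d = card A"
  have tri_real: "real k * (real k + 1) / 2 \<le> real p + 1 \<longleftrightarrow> k \<le> d" for k
  proof -
    have "real k * (real k + 1) / 2 \<le> real p + 1 \<longleftrightarrow> real (k * (k + 1)) \<le> real (2 * p + 2)"
      by (simp add: algebra_simps)
    then show ?thesis
      unfolding d_def using largest_zero_free_card[OF p(2,1) A, of k] by (simp only: of_nat_le_iff)
  qed
  then show d_le: "real (card A) * (real (card A) + 1) / 2 \<le> real p + 1"
    by (simp add: d_def)
  show "k \<le> int (card A)" if "real_of_int k * (real_of_int k + 1) / 2 \<le> real p + 1" for k
  proof (cases "k \<ge> 0")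
    case True
    then show ?thesis
      using that tri_real[of "nat k"] by (simp add: d_def)
  qed simp
  have Suc_d: "\<not> (real d + 1) * (real d + 2) / 2 \<le> real p + 1"
    using tri_real[of "d + 1"] by (simp add: add.commute add.left_commute)
  show "int (card A) = \<lfloor>sqrt (2 * real p + 9 / 4) - 1 / 2\<rfloor>"
  proof (rule floor_unique[symmetric])
    \<comment> \<open>Completing the square: d(d+1)/2 \<le> p+1 is equivalent to (d + 1/2)^2 \<le>
      2p + 9/4, and the upper bound uses the same at d+1.\<close>
    have "real d + 1 / 2 \<le> sqrt (2 * real p + 9 / 4)"
      using d_le by (intro real_le_rsqrt) (simp add: d_def power2_eq_square field_simps)
    then show "real_of_int (int (card A)) \<le> sqrt (2 * real p + 9 / 4) - 1 / 2"
      by (simp add: d_def)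
    have "sqrt (2 * real p + 9 / 4) < real d + 3 / 2"
      using Suc_d by (intro real_less_lsqrt) (simp_all add: power2_eq_square field_simps)
    then show "sqrt (2 * real p + 9 / 4) - 1 / 2 < real_of_int (int (card A)) + 1"
      by (simp add: d_def)
  qed
  define r where "r = nat \<lfloor>sqrt (2 * real p)\<rfloor>"
  have r: "\<lfloor>sqrt (2 * real p)\<rfloor> = int r"
    by (simp add: r_def)
  have "real r \<le> sqrt (2 * real p)" "sqrt (2 * real p) < real r + 1"
    using floor_correct[of "sqrt (2 * real p)"] unfolding r by simp_all
  then have "real r ^ 2 \<le> sqrt (2 * real p) ^ 2" "sqrt (2 * real p) ^ 2 < (real r + 1) ^ 2"
    by (intro power_mono power_strict_mono; simp)+
  then have r_bounds: "real r * real r \<le> 2 * real p" "2 * real p < (real r + 1) * (real r + 1)"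
    by (simp_all add: power2_eq_square)
  have "r \<ge> 1"
    using r_bounds(2) p by (cases r) auto
  \<comment> \<open>Since (r-1)r \<le> r^2 \<le> 2p and (r+1)(r+2) = (r+1)^2 + (r+1) > 2p+2,
    \<open>d\<close> is \<open>r\<close> or \<open>r - 1\<close>; \<open>delta\<close> tells
    which.\<close>
  have "r \<le> d + 1"
    using tri_real[of "r - 1"] r_bounds(1) \<open>r \<ge> 1\<close> by (simp add: of_nat_diff field_simps)
  moreover have "d \<le> r"
    using tri_real[of "r + 1"] r_bounds(2) \<open>r \<ge> 1\<close> by (simp add: field_simps)
  moreover have "delta p = (if r \<le> d then 0 else 1)"
    using tri_real[of r] by (simp add: delta_def s_fun_def r)
  ultimately show "int (card A) = \<lfloor>sqrt (2 * real p)\<rfloor> - delta p"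
    by (auto simp: r d_def)
qed

end
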